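(* The following series identity holds: $$\sum_{k=0}^{\infty}\left(\frac{16}{27}\right)^k\frac{(1)_k^2}{(\frac{7}{6})_k(\frac{11}{6})_k}\left\{\frac{21+22k}{1+2k}H_{1+2k}^{(2)}-\frac{145+174k}{(1+2k)^3}\right\}=-120\beta(4).$$
   Context: For a complex number $x$ and a nonnegative integer $n$, the shifted factorial is $(x)_0=1$ and $(x)_n=x(x+1)\cdots(x+n-1)$ for $n\ge 1$; $(x)_n^m$ denotes $((x)_n)^m$. The harmonic numbers of order 2 are $H_n^{(2)}=\sum_{j=1}^n \frac{1}{j^2}$ for positive integers $n$. The constant $\beta(4)$ is $\beta(4)=\sum_{k=0}^{\infty}\frac{(-1)^k}{(1+2k)^4}$. *)

theory Defs
  imports "HOL-Analysis.Analysis"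
begin

definition harm2 :: "nat \<Rightarrow> real" where
  "harm2 n = (\<Sum>j=1..n. 1 / real j ^ 2)"

definition beta4 :: real where
  "beta4 = (\<Sum>k. (-1) ^ k / (1 + 2 * real k) ^ 4)"

end

theory Submission
  imports Defs "HOL-Real_Asymp.Real_Asymp"
begin

text \<open>
  Write \<open>x = N + 1/2\<close>, \<open>Q\<^sub>M(x) = (1 - x\<^sup>2/1\<^sup>2) \<dots> (1 - x\<^sup>2/M\<^sup>2)\<close> and consider
  \<open>(-1)\<^sup>N Q\<^sub>2\<^sub>k(t) / ((x\<^sup>2 - t\<^sup>2) Q\<^sub>2\<^sub>k(x))\<close>. For \<open>k = 0\<close> its \<open>t\<^sup>2\<close>-coefficient is
  \<open>(-1)\<^sup>N / x\<^sup>4\<close>. Passing from \<open>k\<close> to \<open>k + 1\<close> cancels the factor \<open>x\<^sup>2 - t\<^sup>2\<close>, and the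
  difference is Gosper-summable in \<open>N\<close>. So the sums \<open>S\<^sub>k\<close> over \<open>N \<ge> k\<close> of the \<open>t\<^sup>2\<close>-coefficients
  start at \<open>S\<^sub>0 = 16 \<beta>(4)\<close>, tend to \<open>0\<close>, and have explicit differences, which are the terms of
  the series up to the factor \<open>-2/15\<close>.
\<close>

section \<open>Truncations of Euler's product for sin(pi x) / (pi x), at half-integers\<close>

definition sinprod :: "nat \<Rightarrow> real \<Rightarrow> real" where
  "sinprod M x = (\<Prod>j=1..M. 1 - x\<^sup>2 / (real j)\<^sup>2)"

lemma sinprod_0 [simp]: "sinprod 0 x = 1"
  by (simp add: sinprod_def)

lemma sinprod_Suc: "sinprod (Suc M) x = sinprod M x * (1 - x\<^sup>2 / (real M + 1)\<^sup>2)"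
  by (simp add: sinprod_def add.commute)

lemma harm2_Suc: "harm2 (Suc n) = harm2 n + 1 / (real n + 1)\<^sup>2"
  by (simp add: harm2_def add.commute)

lemma half_int_neq_nat: "real N + 1/2 \<noteq> real j"
proof
  assume "real N + 1/2 = real j"
  then have "real (2 * N + 1) = real (2 * j)" by simp
  then have "2 * N + 1 = 2 * j" by (rule of_nat_eq_iff[THEN iffD1])
  then show False by presburger
qed

text \<open>The only zeros are nonzero integers, so every division by \<open>sinprod\<close> at a
  half-integer below is genuine.\<close>

lemma sinprod_half_int_nonzero: "sinprod M (real N + 1/2) \<noteq> 0"
proof -
  have "1 - (real N + 1/2)\<^sup>2 / (real j)\<^sup>2 \<noteq> 0" if "j \<in> {1..M}" for j
  proof
    assume "1 - (real N + 1/2)\<^sup>2 / (real j)\<^sup>2 = 0"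
    then have "(real N + 1/2)\<^sup>2 = (real j)\<^sup>2" using that by (simp add: field_simps)
    then show False
      using half_int_neq_nat[of N j] by (simp add: power2_eq_iff_nonneg)
  qed
  then show ?thesis by (simp add: sinprod_def)
qed

text \<open>Each factor is (j - x)(j + x)/j^2. Under x -> x + 1 the products of j - x and of j + x
  each telescope, so only end factors survive. With denominators cleared the relation also holds at
  the integers.\<close>

lemma sinprod_shift:
  "sinprod M (x + 1) * ((x + 1) * (x - real M)) = sinprod M x * (x * (x + real M + 1))"
proof (induction M)
  case 0
  show ?case by simp
next
  case (Suc M)
  define m where "m = real M"
  have m: "m + 1 \<noteq> 0" by (simp add: m_def add_nonneg_eq_0_iff)
  have "sinprod (Suc M) (x + 1) * ((x + 1) * (x - real (Suc M)))
      = sinprod M (x + 1) * ((x + 1) * (x - m)) * ((x + m + 2) * (m + 1 - x) / (m + 1)\<^sup>2)"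
    using m by (simp add: sinprod_Suc m_def[symmetric] divide_simps) algebra
  also have "\<dots> = sinprod M x * (x * (x + m + 1)) * ((x + m + 2) * (m + 1 - x) / (m + 1)\<^sup>2)"
    by (simp only: Suc.IH m_def)
  also have "\<dots> = sinprod (Suc M) x * (x * (x + real (Suc M) + 1))"
    using m by (simp add: sinprod_Suc m_def[symmetric] divide_simps) algebra
  finally show ?case .
qed

section \<open>A pair of sequences telescoping in N\<close>

definition wzF :: "nat \<Rightarrow> nat \<Rightarrow> real" where
  "wzF k N = (let x = real N + 1/2 in
     (-1) ^ N * (1 / x ^ 4 - harm2 (2 * k) / x\<^sup>2) / sinprod (2 * k) x)"

text \<open>The Gosper antidifference. With c the bracket that multiplies
  \<open>harm2 (2 * k)\<close>, the factor 1 - \<open>harm2 (2 * k)\<close> c is the t^2-coefficient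
  of Q(t) (t^2 + c), where Q is \<open>sinprod (2 * k)\<close> and has expansion 1 -
  \<open>harm2 (2 * k)\<close> t^2 + ... .\<close>

definition wzG :: "nat \<Rightarrow> nat \<Rightarrow> real" where
  "wzG k N = (let x = real N + 1/2; a = 2 * real k + 1; b = 2 * real k + 2 in
     (-1) ^ N * (1 - harm2 (2 * k) * ((real N)\<^sup>2 - a\<^sup>2 - b\<^sup>2 + b - 1/4)) * (x + b)
       / (2 * x * a\<^sup>2 * b\<^sup>2 * sinprod (2 * k + 2) x))"

text \<open>Over the common denominator \<open>sinprod (2 * k + 2) x\<close>, the left side is
  (-1)^N (1 - H (x^2 - a^2 - b^2)) / (a^2 b^2): the negative powers of x cancel. The right side
  reduces to the same expression by \<open>sinprod_shift\<close>.\<close>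

lemma wz_pair: "wzF k N - wzF (Suc k) N = wzG k N - wzG k (Suc N)"
proof -
  define x where "x = real N + 1/2"
  define a where "a = 2 * real k + 1"
  define b where "b = 2 * real k + 2"
  define q where "q = sinprod (2 * k + 2) x"
  define H where "H = harm2 (2 * k)"
  define s :: real where "s = (-1) ^ N"
  have pos: "x > 0" "a > 0" "b > 0" by (simp_all add: x_def a_def b_def add_nonneg_pos)
  have nz: "x \<noteq> 0" "a \<noteq> 0" "b \<noteq> 0" "x + 1 \<noteq> 0" "x + b + 1 \<noteq> 0" using pos by auto
  have q0: "q \<noteq> 0" "sinprod (2 * k) x \<noteq> 0"
    unfolding q_def x_def by (rule sinprod_half_int_nonzero)+
  have xb: "x - b \<noteq> 0"
    using half_int_neq_nat[of N "2 * k + 2"] by (simp add: x_def b_def)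
  have H': "harm2 (2 * Suc k) = H + 1 / a\<^sup>2 + 1 / b\<^sup>2"
    by (simp add: harm2_Suc H_def a_def b_def add.commute)
  have q: "q = sinprod (2 * k) x * ((1 - x\<^sup>2 / a\<^sup>2) * (1 - x\<^sup>2 / b\<^sup>2))"
    by (simp add: q_def sinprod_Suc a_def b_def add.commute)
  have "sinprod (2 * k + 2) (x + 1) * ((x + 1) * (x - b)) = q * (x * (x + b + 1))"
    using sinprod_shift[of "2 * k + 2" x] by (simp add: q_def b_def add_ac)
  then have qs: "sinprod (2 * k + 2) (x + 1) = q * (x * (x + b + 1)) / ((x + 1) * (x - b))"
    using nz xb by (simp add: eq_divide_eq)
  define r where "r = (1 - x\<^sup>2 / a\<^sup>2) * (1 - x\<^sup>2 / b\<^sup>2)"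
  have r0: "r \<noteq> 0" using q q0 by (auto simp: r_def)
  have F: "wzF k N = s * (1 / x ^ 4 - H / x\<^sup>2) * r / q"
    using q0 r0 by (simp add: wzF_def Let_def x_def[symmetric] q r_def[symmetric] s_def H_def)
  have F': "wzF (Suc k) N = s * (1 / x ^ 4 - (H + 1 / a\<^sup>2 + 1 / b\<^sup>2) / x\<^sup>2) / q"
    unfolding wzF_def Let_def x_def[symmetric] H' by (simp add: q_def s_def)
  have G: "wzG k N = s * (1 - H * ((x - 1/2)\<^sup>2 - a\<^sup>2 - b\<^sup>2 + b - 1/4)) * (x + b)
       / (2 * x * a\<^sup>2 * b\<^sup>2 * q)"
    by (simp add: wzG_def Let_def x_def[symmetric] q_def s_def H_def a_def b_def)
      (simp add: x_def)
  have "wzG k (Suc N) = - s * (1 - H * ((x + 1/2)\<^sup>2 - a\<^sup>2 - b\<^sup>2 + b - 1/4)) * (x + 1 + b)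
       / (2 * (x + 1) * a\<^sup>2 * b\<^sup>2 * sinprod (2 * k + 2) (x + 1))"
    by (simp add: wzG_def Let_def s_def H_def a_def b_def x_def add_ac)
  \<comment> \<open>The shift relation trades the denominator at x + 1 for the one at x. The factor
    x + b + 1 cancels and x - b enters the numerator, so both values of \<open>wzG\<close> share one
    denominator.\<close>
  also have "\<dots> = - s * (1 - H * ((x + 1/2)\<^sup>2 - a\<^sup>2 - b\<^sup>2 + b - 1/4)) * (x - b)
       / (2 * x * a\<^sup>2 * b\<^sup>2 * q)"
  proof -
    have "c * w / (2 * (x + 1) * a\<^sup>2 * b\<^sup>2 * (q * (x * w) / ((x + 1) * (x - b)))) = c * (x - b) / (2 * x * a\<^sup>2 * b\<^sup>2 * q)"
      if "w \<noteq> 0" for c w :: real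
      using that nz xb q0 by (simp add: divide_simps) algebra
    note cancel = this[OF nz(5)]
    have "x + 1 + b = x + b + 1" by simp
    then show ?thesis unfolding qs by (simp only: cancel)
  qed
  finally have G': "wzG k (Suc N) = \<dots>" .
  \<comment> \<open>What remains after removing \<open>s / q\<close> is a rational identity in x, a,
    b and H. The weights x + b and x - b add up to 2 x, and their difference accounts for the b in
    the bracket.\<close>
  have "(1 / x ^ 4 - H / x\<^sup>2) * r - (1 / x ^ 4 - (H + 1 / a\<^sup>2 + 1 / b\<^sup>2) / x\<^sup>2)
      = ((1 - H * ((x - 1/2)\<^sup>2 - a\<^sup>2 - b\<^sup>2 + b - 1/4)) * (x + b)
        + (1 - H * ((x + 1/2)\<^sup>2 - a\<^sup>2 - b\<^sup>2 + b - 1/4)) * (x - b)) / (2 * x * a\<^sup>2 * b\<^sup>2)"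
    unfolding r_def using nz by (simp add: divide_simps) algebra
  moreover have "s * A * r / q - s * B / q = s * P * y / (D * q) - - s * P' * z / (D * q)"
    if "A * r - B = (P * y + P' * z) / D" for A B P P' y z D
  proof -
    have "s * A * r / q - s * B / q = s * (A * r - B) / q"
      by (simp add: ring_distribs diff_divide_distrib mult.assoc)
    also have "\<dots> = s * ((P * y + P' * z) / D) / q" by (simp only: that)
    also have "\<dots> = s * P * y / (D * q) - - s * P' * z / (D * q)"
      by (simp add: ring_distribs add_divide_distrib mult.assoc)
    finally show ?thesis .
  qed
  ultimately show ?thesis
    unfolding F F' G G' by blast
qed

text \<open>By \<open>sinprod_shift\<close>, one step in N multiplies the absolute value by x (x + m
  + 1) / ((x + 1) |x - m|) with m = 2 k, and this ratio is at least 1 from N = k on.\<close>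

lemma sinprod_tail:
  assumes "k \<le> N"
  shows "\<bar>sinprod (2 * k) (real k + 1/2)\<bar> \<le> \<bar>sinprod (2 * k) (real N + 1/2)\<bar>"
  using assms
proof (induction N rule: dec_induct)
  case base
  show ?case by simp
next
  case (step N)
  define x where "x = real N + 1/2"
  define m where "m = real (2 * k)"
  have x: "x > 0" "m \<ge> 0" "2 * x \<ge> m + 1" using step.hyps by (auto simp: x_def m_def)
  have eq: "\<bar>sinprod (2 * k) (x + 1)\<bar> * ((x + 1) * \<bar>x - m\<bar>) = \<bar>sinprod (2 * k) x\<bar> * (x * (x + m + 1))"
    using arg_cong[OF sinprod_shift[of "2 * k" x], of abs] x
    by (simp add: abs_mult m_def)
  have le: "(x + 1) * \<bar>x - m\<bar> \<le> x * (x + m + 1)"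
  proof (cases "x \<ge> m")
    case True
    have "0 \<le> m * x" using x by simp
    then show ?thesis using True x by (simp add: algebra_simps)
  next
    case False
    have "m + 1 \<le> 2 * x" "0 \<le> x" using x by auto
    \<comment> \<open>For x < m the required inequality simplifies to exactly this one. It follows
      from m + 1 \<le> 2 x, which is where N \<ge> k enters.\<close>
    have "m \<le> 2 * x\<^sup>2 + 2 * x" using x zero_le_power2[of x] by linarith
    then show ?thesis using False by (simp add: algebra_simps power2_eq_square)
  qed
  have pos: "(x + 1) * \<bar>x - m\<bar> > 0"
    using half_int_neq_nat[of N "2 * k"] x by (simp add: x_def m_def)
  have "\<bar>sinprod (2 * k) x\<bar> * ((x + 1) * \<bar>x - m\<bar>) \<le> \<bar>sinprod (2 * k) (x + 1)\<bar> * ((x + 1) * \<bar>x - m\<bar>)"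
    unfolding eq using le by (intro mult_left_mono) auto
  then have "\<bar>sinprod (2 * k) x\<bar> \<le> \<bar>sinprod (2 * k) (x + 1)\<bar>"
    using pos by (simp only: mult_le_cancel_right_pos)
  then show ?case using step.IH by (simp add: x_def add_ac)
qed

section \<open>The diagonal N = k and the terms of the series\<close>

definition seriesA :: "nat \<Rightarrow> real" where
  "seriesA k = (16 / 27) ^ k * ((pochhammer 1 k)\<^sup>2 / (pochhammer (7 / 6) k * pochhammer (11 / 6) k))"

lemma seriesA_Suc:
  "seriesA (Suc k) = seriesA k * (64 * (real k + 1)\<^sup>2 / (3 * (6 * real k + 7) * (6 * real k + 11)))"
proof -
  have "16 / 27 * ((real k + 1)\<^sup>2 / ((7/6 + real k) * (11/6 + real k)))
      = 64 * (real k + 1)\<^sup>2 / (3 * (6 * real k + 7) * (6 * real k + 11))"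
    by (simp add: divide_simps) algebra
  moreover have "seriesA (Suc k) = seriesA k * (16 / 27 * ((real k + 1)\<^sup>2 / ((7/6 + real k) * (11/6 + real k))))"
    by (simp add: seriesA_def pochhammer_Suc power_mult_distrib add.commute[of 1] mult_ac)
  ultimately show ?thesis by simp
qed

text \<open>This is where (16/27)^k and the Pochhammer symbols come from. Passing from k to k + 1
  shifts the argument by 1 and appends two factors; the resulting rational ratio agrees with that of
  the right side.\<close>

lemma sinprod_diag:
  "(-1) ^ k / sinprod (2 * k) (real k + 1/2) = (2 * real k + 1) * (6 * real k + 5) / 5 * seriesA k"
proof (induction k)
  case 0
  show ?case by (simp add: seriesA_def)
next
  case (Suc k)
  define u where "u = real k"
  define q where "q = sinprod (2 * k) (u + 1/2)"
  define q' where "q' = sinprod (2 * k) (u + 1/2 + 1)"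
  have u: "u \<ge> 0" by (simp add: u_def)
  have q0: "q \<noteq> 0" unfolding q_def u_def by (rule sinprod_half_int_nonzero)
  have "q' * ((u + 3/2) * (1/2 - u)) = q * ((u + 1/2) * (3 * u + 3/2))"
    using sinprod_shift[of "2 * k" "u + 1/2"] by (simp add: q_def q'_def u_def add_ac)
  moreover have u': "1/2 - u \<noteq> 0" using half_int_neq_nat[of 0 k] by (simp add: u_def)
  ultimately have q': "q' = q * ((u + 1/2) * (3 * u + 3/2)) / ((u + 3/2) * (1/2 - u))"
    using u by (simp add: eq_divide_eq)
  have "sinprod (2 * Suc k) (real (Suc k) + 1/2)
      = q' * ((1 - (u + 3/2)\<^sup>2 / (2 * u + 1)\<^sup>2) * (1 - (u + 3/2)\<^sup>2 / (2 * u + 2)\<^sup>2))"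
    by (simp add: sinprod_Suc q'_def u_def add_ac)
  \<comment> \<open>The first appended factor has numerator (u - 1/2)(3 u + 5/2). Its u - 1/2
    cancels the 1/2 - u of the shift, and the minus sign left over is absorbed by
    \<open>(-1) ^ k\<close>.\<close>
  also have "\<dots> = - q * (3 * (2 * u + 1) * (6 * u + 5) * (6 * u + 7)) / (64 * (2 * u + 3) * (u + 1)\<^sup>2)"
    unfolding q' using u u' by (simp add: divide_simps) algebra
  finally have step: "sinprod (2 * Suc k) (real (Suc k) + 1/2) = \<dots>" .
  have A: "seriesA (Suc k) = seriesA k * (64 * (u + 1)\<^sup>2 / (3 * (6 * u + 7) * (6 * u + 11)))"
    unfolding u_def by (rule seriesA_Suc)
  have nz: "2 * u + 1 \<noteq> 0" "6 * u + 5 \<noteq> 0" "6 * u + 7 \<noteq> 0" "6 * u + 11 \<noteq> 0" "2 * u + 3 \<noteq> 0" "u + 1 \<noteq> 0"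
    using u by auto
  have "(-1) ^ Suc k / sinprod (2 * Suc k) (real (Suc k) + 1/2)
      = (-1) ^ k / q * (64 * (2 * u + 3) * (u + 1)\<^sup>2 / (3 * (2 * u + 1) * (6 * u + 5) * (6 * u + 7)))"
    unfolding step using q0 nz by (simp add: divide_simps)
  also have "(-1) ^ k / q = (2 * u + 1) * (6 * u + 5) / 5 * seriesA k"
    using Suc.IH by (simp add: q_def u_def)
  also have "(2 * u + 1) * (6 * u + 5) / 5 * seriesA k
      * (64 * (2 * u + 3) * (u + 1)\<^sup>2 / (3 * (2 * u + 1) * (6 * u + 5) * (6 * u + 7)))
      = (2 * u + 3) * (6 * u + 11) / 5 * seriesA (Suc k)"
    unfolding A using nz by (simp add: divide_simps) algebra
  finally show ?case by (simp add: u_def algebra_simps)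
qed

text \<open>The left side is what is lost from \<open>S k\<close> to \<open>S (Suc k)\<close>: the
  term N = k, and the telescoped rest starting at N = k + 1.\<close>

lemma wz_boundary:
  "wzF k k + wzG k (Suc k) = - 2 / 15 * (seriesA k
     * ((21 + 22 * real k) / (1 + 2 * real k) * harm2 (1 + 2 * k) - (145 + 174 * real k) / (1 + 2 * real k) ^ 3))"
proof -
  define u where "u = real k"
  define H where "H = harm2 (2 * k)"
  have u: "u \<ge> 0" by (simp add: u_def)
  have nz: "2 * u + 1 \<noteq> 0" "6 * u + 5 \<noteq> 0" "6 * u + 7 \<noteq> 0" "6 * u + 11 \<noteq> 0" "2 * u + 3 \<noteq> 0" "u + 1 \<noteq> 0"
    "u + 1/2 \<noteq> 0" "u + 3/2 \<noteq> 0" "2 * u + 2 \<noteq> 0"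
    using u by auto
  have A: "seriesA (Suc k) = seriesA k * (64 * (u + 1)\<^sup>2 / (3 * (6 * u + 7) * (6 * u + 11)))"
    unfolding u_def by (rule seriesA_Suc)
  have "wzF k k = (-1) ^ k / sinprod (2 * k) (real k + 1/2) * (1 / (u + 1/2) ^ 4 - H / (u + 1/2)\<^sup>2)"
    by (simp add: wzF_def Let_def u_def H_def)
  then have F: "wzF k k = (2 * u + 1) * (6 * u + 5) / 5 * seriesA k * (1 / (u + 1/2) ^ 4 - H / (u + 1/2)\<^sup>2)"
    by (simp add: sinprod_diag u_def)
  \<comment> \<open>Since \<open>wzG k\<close> contains \<open>sinprod (2 * k + 2)\<close>, its
    value at N = k + 1 is again a diagonal one, so \<open>sinprod_diag\<close> applies at k +
    1.\<close>
  have "wzG k (Suc k) = (-1) ^ Suc k / sinprod (2 * Suc k) (real (Suc k) + 1/2)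
      * ((1 - H * ((u + 1)\<^sup>2 - (2 * u + 1)\<^sup>2 - (2 * u + 2)\<^sup>2 + (2 * u + 2) - 1/4)) * (3 * u + 7/2)
        / (2 * (u + 3/2) * (2 * u + 1)\<^sup>2 * (2 * u + 2)\<^sup>2))"
    by (simp add: wzG_def Let_def u_def H_def add_ac mult_ac)
  also have "(-1) ^ Suc k / sinprod (2 * Suc k) (real (Suc k) + 1/2)
      = (2 * u + 3) * (6 * u + 11) / 5 * (seriesA k * (64 * (u + 1)\<^sup>2 / (3 * (6 * u + 7) * (6 * u + 11))))"
    unfolding sinprod_diag A by (simp add: u_def algebra_simps)
  finally have G: "wzG k (Suc k) = \<dots>
      * ((1 - H * ((u + 1)\<^sup>2 - (2 * u + 1)\<^sup>2 - (2 * u + 2)\<^sup>2 + (2 * u + 2) - 1/4)) * (3 * u + 7/2)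
        / (2 * (u + 3/2) * (2 * u + 1)\<^sup>2 * (2 * u + 2)\<^sup>2))" .
  have H': "harm2 (1 + 2 * k) = H + 1 / (2 * u + 1)\<^sup>2"
    using harm2_Suc[of "2 * k"] by (simp add: H_def u_def)
  have coeff: "(2 * u + 3) * (6 * u + 11) / 5 * (64 * (u + 1)\<^sup>2 / (3 * (6 * u + 7) * (6 * u + 11)))
      * ((3 * u + 7/2) / (2 * (u + 3/2) * (2 * u + 1)\<^sup>2 * (2 * u + 2)\<^sup>2)) = 8 / (15 * (2 * u + 1)\<^sup>2)"
  proof -
    have "(2 * u + 2)\<^sup>2 = 4 * (u + 1)\<^sup>2" "3 * u + 7/2 = (6 * u + 7) / 2" "2 * (u + 3/2) = 2 * u + 3"
      by (simp_all add: power2_eq_square algebra_simps)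
    then show ?thesis using nz by (simp add: divide_simps) (simp add: algebra_simps)
  qed
  have reorder: "p * (y * z) * (w * t / d) = y * (p * z * (t / d) * w)" for p y z w t d :: real
    by simp
  have G': "wzG k (Suc k) = seriesA k * (8 / (15 * (2 * u + 1)\<^sup>2)
      * (1 - H * ((u + 1)\<^sup>2 - (2 * u + 1)\<^sup>2 - (2 * u + 2)\<^sup>2 + (2 * u + 2) - 1/4)))"
    unfolding G reorder coeff ..
  define v where "v = 2 * u + 1"
  have v: "v \<noteq> 0" using nz by (simp add: v_def)
  have uv: "u + 1/2 = v / 2" "6 * u + 5 = 3 * v + 2" "(145 + 174 * u) = 87 * v + 58" "21 + 22 * u = 11 * v + 10"
    "(u + 1)\<^sup>2 - v\<^sup>2 - (2 * u + 2)\<^sup>2 + (2 * u + 2) - 1/4 = - (7 * v\<^sup>2 + 2 * v) / 4"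
    by (simp_all add: v_def power2_eq_square algebra_simps)
  \<comment> \<open>In the odd number v = 2 k + 1 the claim splits into an H-free part over 15 v^3
    and an H-part over 15 v, compared separately.\<close>
  have "v * (3 * v + 2) / 5 * (1 / (v / 2) ^ 4 - H / (v / 2)\<^sup>2)
      + 8 / (15 * v\<^sup>2) * (1 - H * (- (7 * v\<^sup>2 + 2 * v) / 4))
     = - 2 / 15 * ((11 * v + 10) / v * (H + 1 / v\<^sup>2) - (87 * v + 58) / v ^ 3)"
  proof -
    have "v * (3 * v + 2) / 5 * (1 / (v / 2) ^ 4 - H / (v / 2)\<^sup>2)
        = 16 * (3 * v + 2) / (5 * v ^ 3) - 4 * (3 * v + 2) * H / (5 * v)"
      using v by (simp add: right_diff_distrib power_divide power2_eq_square power3_eq_cube power4_eq_xxxx)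
        (simp add: algebra_simps)
    moreover have "8 / (15 * v\<^sup>2) * (1 - H * (- (7 * v\<^sup>2 + 2 * v) / 4))
        = 8 * v / (15 * v ^ 3) + (14 * v + 4) * H / (15 * v)"
    proof -
      have "1 - H * (- (7 * v\<^sup>2 + 2 * v) / 4) = 1 + v * ((14 * v + 4) * H) / 8"
        by (simp add: power2_eq_square field_simps)
      then have "8 / (15 * v\<^sup>2) * (1 - H * (- (7 * v\<^sup>2 + 2 * v) / 4))
          = 8 / (15 * v\<^sup>2) + v * ((14 * v + 4) * H) / (v * (15 * v))"
        by (simp only: distrib_left times_divide_times_eq power2_eq_square)
      moreover have "8 / (15 * v\<^sup>2) = 8 * v / (15 * v ^ 3)"
        using v by (simp add: power2_eq_square power3_eq_cube)
      ultimately show ?thesis using v by simp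
    qed
    moreover have "- 2 / 15 * ((11 * v + 10) / v * (H + 1 / v\<^sup>2) - (87 * v + 58) / v ^ 3)
        = (152 * v + 96) / (15 * v ^ 3) - (22 * v + 20) * H / (15 * v)"
    proof -
      have "(11 * v + 10) / v * (H + 1 / v\<^sup>2) = (11 * v + 10) * H / v + (11 * v + 10) / v ^ 3"
        by (simp add: distrib_left power2_eq_square power3_eq_cube)
      moreover have "(152 * v + 96) / (15 * v ^ 3) = 2 / 15 * ((87 * v + 58) / v ^ 3 - (11 * v + 10) / v ^ 3)"
        by (simp add: diff_divide_distrib[symmetric])
      moreover have "(22 * v + 20) * H / (15 * v) = 2 / 15 * ((11 * v + 10) * H / v)"
        by (simp only: times_divide_times_eq) simp
      moreover have "- 2 / 15 * (p + q - r) = 2 / 15 * (r - q) - 2 / 15 * p" for p q r :: real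
        by (simp add: field_simps)
      ultimately show ?thesis by (simp only:)
    qed
    moreover have "16 * (3 * v + 2) / (5 * v ^ 3) + 8 * v / (15 * v ^ 3) = (152 * v + 96) / (15 * v ^ 3)"
      using v by (simp add: divide_simps)
    moreover have "(14 * v + 4) * H / (15 * v) - 4 * (3 * v + 2) * H / (5 * v) = - ((22 * v + 20) * H / (15 * v))"
      using v by (simp add: field_simps)
    moreover have "p - q + (p' + q') = p'' - q''" if "p + p' = p''" "q' - q = - q''" for p q p' q' p'' q'' :: real
      using that by linarith
    ultimately show ?thesis by (simp only:)
  qed
  moreover have "p * seriesA k * K + seriesA k * L = - 2 / 15 * (seriesA k * R)"
    if "p * K + L = - 2 / 15 * R" for p K L R
  proof -
    have "p * seriesA k * K + seriesA k * L = seriesA k * (p * K + L)" by (simp add: algebra_simps)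
    then show ?thesis by (simp add: that)
  qed
  ultimately show ?thesis
    unfolding F G' H' u_def[symmetric] add.commute[of 1 "2 * u"] v_def[symmetric] uv by blast
qed

section \<open>Uniform bounds and vanishing boundary terms\<close>

lemma seriesA_bounds: "0 < seriesA k" "seriesA k \<le> (16 / 27) ^ k"
proof -
  have le: "pochhammer 1 k \<le> pochhammer c k" if "c \<ge> 1" for c :: real
    using that unfolding pochhammer_prod by (intro prod_mono) auto
  have pos: "pochhammer c k > 0" if "c \<ge> 1" for c :: real
    using that by (intro pochhammer_pos) auto
  show "0 < seriesA k"
    unfolding seriesA_def by (intro mult_pos_pos divide_pos_pos zero_less_power pos) auto
  have "(pochhammer 1 k)\<^sup>2 \<le> pochhammer (7/6) k * pochhammer (11/6 :: real) k"
    unfolding power2_eq_square using pos[of 1] pos[of "7/6"] by (intro mult_mono le) auto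
  moreover have "pochhammer (7/6) k * pochhammer (11/6 :: real) k > 0" by (intro mult_pos_pos pos) auto
  ultimately have "(pochhammer 1 k)\<^sup>2 / (pochhammer (7/6) k * pochhammer (11/6 :: real) k) \<le> 1"
    by simp
  then show "seriesA k \<le> (16 / 27) ^ k"
    unfolding seriesA_def by (intro mult_left_le) auto
qed

text \<open>\<open>C\<close> is independent of k: one estimate gives convergence in N and, through
  the geometric decay of \<open>seriesA\<close>, the limit in k. The factor before \<open>C\<close>
  is the reciprocal of the diagonal \<open>sinprod\<close>, the worst case by
  \<open>sinprod_tail\<close>.\<close>

lemma wzF_bound:
  obtains C where "C \<ge> 0"
    "\<And>k n. \<bar>wzF k (n + k)\<bar> \<le> (2 * real k + 1) * (6 * real k + 5) / 5 * seriesA k * (C / (real n + 1)\<^sup>2)"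
proof -
  have sm: "summable (\<lambda>j. 1 / (real j + 1)\<^sup>2)"
    using inverse_power_summable[of 2, where 'a = real, THEN summable_Suc_iff[THEN iffD2]]
    by (simp add: inverse_eq_divide add_ac)
  define Z where "Z = (\<Sum>j. 1 / (real j + 1)\<^sup>2)"
  have "harm2 m = (\<Sum>j<m. 1 / (real j + 1)\<^sup>2)" for m
    by (induction m) (simp_all add: harm2_Suc, simp add: harm2_def)
  then have Z: "0 \<le> harm2 m" "harm2 m \<le> Z" for m
    unfolding Z_def by (auto intro!: sum_nonneg sum_le_suminf sm)
  have Z0: "Z \<ge> 0" using Z[of 0] by linarith
  show thesis
  \<comment> \<open>Here \<open>Z\<close> is zeta(2), a bound for all \<open>harm2\<close>. As x
    \<ge> 1/2, 1/x^4 is at most 4/x^2, giving (4 + Z)/x^2; then 1/x^2 \<le> 4/(n + 1)^2.\<close>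
  proof (rule that[of "16 + 4 * Z"])
    show "0 \<le> 16 + 4 * Z" using Z0 by simp
    fix k n
    define x where "x = real (n + k) + 1/2"
    define V where "V = (2 * real k + 1) * (6 * real k + 5) / 5 * seriesA k"
    have V: "V > 0"
      unfolding V_def using seriesA_bounds(1)[of k] by (intro mult_pos_pos divide_pos_pos) auto
    have "V = \<bar>(-1) ^ k / sinprod (2 * k) (real k + 1/2)\<bar>"
      using V by (simp only: sinprod_diag V_def[symmetric] abs_of_pos)
    then have "V = 1 / \<bar>sinprod (2 * k) (real k + 1/2)\<bar>" by (simp add: abs_divide power_abs)
    moreover have "1 / \<bar>sinprod (2 * k) x\<bar> \<le> 1 / \<bar>sinprod (2 * k) (real k + 1/2)\<bar>"
      unfolding x_def using sinprod_half_int_nonzero[of "2 * k" k]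
      by (intro divide_left_mono sinprod_tail) (auto simp: sinprod_half_int_nonzero simp flip: of_nat_add)
    ultimately have q: "1 / \<bar>sinprod (2 * k) x\<bar> \<le> V" by simp
    have x: "(real n + 1) / 2 \<le> x" "1/2 \<le> x" "0 < x" by (simp_all add: x_def)
    have "1 / x\<^sup>2 \<le> 1 / ((real n + 1) / 2)\<^sup>2" "1 / x\<^sup>2 \<le> 1 / (1/2)\<^sup>2"
      using x by (intro divide_left_mono power_mono mult_pos_pos zero_less_power; simp)+
    then have x2: "1 / x\<^sup>2 \<le> 4 / (real n + 1)\<^sup>2" "1 / x\<^sup>2 \<le> 4" by (simp_all add: power_divide)
    have "1 / x ^ 4 = 1 / x\<^sup>2 * (1 / x\<^sup>2)" by (simp add: power4_eq_xxxx power2_eq_square)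
    moreover have "1 / x\<^sup>2 * (1 / x\<^sup>2) \<le> 4 * (1 / x\<^sup>2)" using x2 by (intro mult_right_mono) auto
    moreover have "harm2 (2 * k) / x\<^sup>2 \<le> Z * (1 / x\<^sup>2)" "0 \<le> harm2 (2 * k) / x\<^sup>2"
      using Z[of "2 * k"] by (simp_all add: divide_right_mono)
    moreover have "0 \<le> 1 / x\<^sup>2 * (1 / x\<^sup>2)" "0 \<le> 4 * (1 / x\<^sup>2)" "0 \<le> Z * (1 / x\<^sup>2)" using Z0 by simp_all
    ultimately have "\<bar>1 / x ^ 4 - harm2 (2 * k) / x\<^sup>2\<bar> \<le> (4 + Z) * (1 / x\<^sup>2)"
      unfolding abs_le_iff distrib_right by linarith
    also have "\<dots> \<le> (4 + Z) * (4 / (real n + 1)\<^sup>2)" using x2 Z0 by (intro mult_left_mono) auto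
    finally have h: "\<bar>1 / x ^ 4 - harm2 (2 * k) / x\<^sup>2\<bar> \<le> (16 + 4 * Z) / (real n + 1)\<^sup>2" by (simp add: algebra_simps)
    have "\<bar>wzF k (n + k)\<bar> = 1 / \<bar>sinprod (2 * k) x\<bar> * \<bar>1 / x ^ 4 - harm2 (2 * k) / x\<^sup>2\<bar>"
      by (simp add: wzF_def Let_def x_def[symmetric] abs_mult abs_divide power_abs del: of_nat_add)
    also have "\<dots> \<le> V * ((16 + 4 * Z) / (real n + 1)\<^sup>2)" using V by (intro mult_mono q h) auto
    finally show "\<bar>wzF k (n + k)\<bar> \<le> (2 * real k + 1) * (6 * real k + 5) / 5 * seriesA k
        * ((16 + 4 * Z) / (real n + 1)\<^sup>2)" by (simp only: V_def)
  qed
qed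

text \<open>Two factors already have degree 4 in x, which beats the square; the reciprocal of each
  further factor tends to 0.\<close>

lemma square_over_sinprod_tendsto_0:
  "(\<lambda>N. (real N + 1/2)\<^sup>2 / sinprod (M + 2) (real N + 1/2)) \<longlonglongrightarrow> 0"
proof (induction M)
  case 0
  have "(\<lambda>N. (real N + 1/2)\<^sup>2 / ((1 - (real N + 1/2)\<^sup>2) * (1 - (real N + 1/2)\<^sup>2 / 2\<^sup>2))) \<longlonglongrightarrow> 0"
    by real_asymp
  then show ?case by (simp add: numeral_2_eq_2 sinprod_Suc)
next
  case (Suc M)
  define c where "c = real (M + 2) + 1"
  have "c > 0" by (simp add: c_def)
  then have "(\<lambda>N. 1 / (1 - (real N + 1/2)\<^sup>2 / c\<^sup>2)) \<longlonglongrightarrow> 0"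
    by real_asymp
  from tendsto_mult[OF Suc.IH this]
  have "(\<lambda>N. (real N + 1/2)\<^sup>2 / (sinprod (M + 2) (real N + 1/2) * (1 - (real N + 1/2)\<^sup>2 / c\<^sup>2))) \<longlonglongrightarrow> 0"
    by (simp only: times_divide_times_eq mult_1_right mult_zero_right)
  then show ?case by (simp only: add_Suc sinprod_Suc c_def)
qed

lemma wzG_tendsto_0: "wzG k \<longlonglongrightarrow> 0"
proof -
  define a where "a = 2 * real k + 1"
  define b where "b = 2 * real k + 2"
  define H where "H = harm2 (2 * k)"
  define d where "d = a\<^sup>2 + b\<^sup>2 - b + 1/4"
  have ab: "a > 0" "b > 0" by (simp_all add: a_def b_def)
  \<comment> \<open>\<open>g\<close> is \<open>wzG\<close> without the sign and with x^2 /
    \<open>sinprod\<close> split off; it converges to -H / (2 a^2 b^2).\<close>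
  define g where "g N = (1 / (real N + 1/2)\<^sup>2 - H * (((real N)\<^sup>2 - d) / (real N + 1/2)\<^sup>2))
      * ((real N + 1/2 + b) / (real N + 1/2)) / (2 * a\<^sup>2 * b\<^sup>2)" for N
  have "(\<lambda>N. 1 / (real N + 1/2)\<^sup>2) \<longlonglongrightarrow> 0" "(\<lambda>N. (real N + 1/2 + b) / (real N + 1/2)) \<longlonglongrightarrow> 1"
    "(\<lambda>N. ((real N)\<^sup>2 - d) / (real N + 1/2)\<^sup>2) \<longlonglongrightarrow> 1"
    by real_asymp+
  then have "g \<longlonglongrightarrow> (0 - H * 1) * 1 / (2 * a\<^sup>2 * b\<^sup>2)"
    unfolding g_def using ab by (intro tendsto_intros) auto
  from tendsto_mult[OF this square_over_sinprod_tendsto_0[of "2 * k"]]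
  have lim: "(\<lambda>N. g N * ((real N + 1/2)\<^sup>2 / sinprod (2 * k + 2) (real N + 1/2))) \<longlonglongrightarrow> 0"
    by simp
  have bound: "norm (wzG k N) \<le> norm (g N * ((real N + 1/2)\<^sup>2 / sinprod (2 * k + 2) (real N + 1/2)))" for N
  proof -
    define x where "x = real N + 1/2"
    have x: "x \<noteq> 0" by (simp add: x_def add_nonneg_eq_0_iff)
    have "g N * (x\<^sup>2 / sinprod (2 * k + 2) x)
        = (1 - H * ((real N)\<^sup>2 - d)) * (x + b) / (2 * x * a\<^sup>2 * b\<^sup>2 * sinprod (2 * k + 2) x)"
      unfolding g_def x_def[symmetric] using x by (simp add: divide_simps)
    then have "wzG k N = (-1) ^ N * (g N * (x\<^sup>2 / sinprod (2 * k + 2) x))"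
      unfolding wzG_def Let_def x_def[symmetric] a_def[symmetric] b_def[symmetric] H_def[symmetric]
      by (simp add: d_def algebra_simps)
    then show ?thesis by (simp add: abs_mult power_abs x_def)
  qed
  show ?thesis
    by (rule Lim_null_comparison[OF always_eventually[OF allI[OF bound]] tendsto_norm_zero[OF lim]])
qed

section \<open>Telescoping in k\<close>

theorem theorem1p5:
  shows "(\<lambda>k::nat. (16 / 27 :: real) ^ k
            * ((pochhammer 1 k) ^ 2 / (pochhammer (7 / 6) k * pochhammer (11 / 6) k))
            * ((21 + 22 * real k) / (1 + 2 * real k) * harm2 (1 + 2 * k)
               - (145 + 174 * real k) / (1 + 2 * real k) ^ 3))
         sums (- 120 * beta4)"
proof -
  \<comment> \<open>The index n + k restricts the sum to N \<ge> k. This cutoff produces the decay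
    in k: the single term \<open>wzF k 0\<close> does not tend to 0.\<close>
  define S where "S k = (\<Sum>n. wzF k (n + k))" for k
  obtain C where C: "C \<ge> 0"
    "\<And>k n. \<bar>wzF k (n + k)\<bar> \<le> (2 * real k + 1) * (6 * real k + 5) / 5 * seriesA k * (C / (real n + 1)\<^sup>2)"
    by (rule wzF_bound) (rule that)
  have sm: "summable (\<lambda>n. C / (real n + 1)\<^sup>2)"
    using inverse_power_summable[of 2, where 'a = real, THEN summable_Suc_iff[THEN iffD2], THEN summable_mult[of _ C]]
    by (simp add: inverse_eq_divide add_ac)
  have smF: "summable (\<lambda>n. wzF k (n + k))" for k
    by (rule summable_comparison_test'[OF summable_mult[OF sm,
          where c = "(2 * real k + 1) * (6 * real k + 5) / 5 * seriesA k"]])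
      (simp only: real_norm_def C(2))
  have step: "S k - S (Suc k) = wzF k k + wzG k (Suc k)" for k
  proof -
    \<comment> \<open>Without N = k, the sum for k runs over the same N \<ge> k + 1 as
      \<open>S (Suc k)\<close>, so \<open>wz_pair\<close> telescopes term by term.\<close>
    have sF: "summable (\<lambda>n. wzF k (Suc n + k))"
      using smF[of k] by (subst summable_Suc_iff)
    have "(\<lambda>n. wzG k (n + Suc k)) \<longlonglongrightarrow> 0"
      by (rule LIMSEQ_ignore_initial_segment[OF wzG_tendsto_0])
    from telescope_sums'[OF this] have "(\<lambda>n. wzF k (Suc n + k) - wzF (Suc k) (n + Suc k)) sums wzG k (Suc k)"
      by (simp add: wz_pair)
    moreover have "(\<lambda>n. wzF k (Suc n + k) - wzF (Suc k) (n + Suc k)) sums ((\<Sum>n. wzF k (Suc n + k)) - S (Suc k))"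
      unfolding S_def by (intro sums_diff summable_sums sF smF)
    ultimately have "(\<Sum>n. wzF k (Suc n + k)) - S (Suc k) = wzG k (Suc k)"
      by (rule sums_unique2[symmetric])
    then show ?thesis
      using suminf_split_head[OF smF[of k]] by (simp add: S_def)
  qed
  have bound: "norm (S k) \<le> (2 * real k + 1) * (6 * real k + 5) / 5 * (16 / 27) ^ k * (\<Sum>n. C / (real n + 1)\<^sup>2)" for k
  proof -
    have "norm (S k) \<le> (\<Sum>n. (2 * real k + 1) * (6 * real k + 5) / 5 * seriesA k * (C / (real n + 1)\<^sup>2))"
      unfolding S_def using C by (intro norm_suminf_le summable_mult sm) auto
    also have "\<dots> = (2 * real k + 1) * (6 * real k + 5) / 5 * seriesA k * (\<Sum>n. C / (real n + 1)\<^sup>2)"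
      by (rule suminf_mult[OF sm])
    also have "\<dots> \<le> (2 * real k + 1) * (6 * real k + 5) / 5 * (16 / 27) ^ k * (\<Sum>n. C / (real n + 1)\<^sup>2)"
      using C(1) by (intro mult_right_mono mult_left_mono seriesA_bounds suminf_nonneg sm) auto
    finally show ?thesis .
  qed
  have "(\<lambda>k. (2 * real k + 1) * (6 * real k + 5) / 5 * (16 / 27) ^ k * (\<Sum>n. C / (real n + 1)\<^sup>2)) \<longlonglongrightarrow> 0"
    by (rule tendsto_mult_left_zero) real_asymp
  then have S0: "S \<longlonglongrightarrow> 0"
    by (rule Lim_null_comparison[OF always_eventually[OF allI[OF bound]]])
  have "S 0 = 16 * beta4"
  proof -
    \<comment> \<open>At k = 0 the product is empty and \<open>harm2 0\<close> is 0, leaving (-1)^n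
      / (n + 1/2)^4.\<close>
    have "wzF 0 n = 16 * ((-1) ^ n / (1 + 2 * real n) ^ 4)" for n
    proof -
      have "real n + 1/2 = (1 + 2 * real n) / 2" by simp
      then show ?thesis
        unfolding wzF_def Let_def by (simp only: power_divide) (simp add: harm2_def)
    qed
    moreover have "summable (\<lambda>n. 16 * ((-1) ^ n / (1 + 2 * real n) ^ 4))"
      using smF[of 0] calculation by simp
    ultimately have "S 0 = (\<Sum>n. 16 * ((-1) ^ n / (1 + 2 * real n) ^ 4))"
      and "summable (\<lambda>n. (-1) ^ n / (1 + 2 * real n) ^ 4 :: real)"
      unfolding S_def by (simp_all only: add_0_right summable_cmult_iff) simp
    then show ?thesis
      unfolding beta4_def by (simp only: suminf_mult)
  qed
  with telescope_sums'[OF S0] have "(\<lambda>k. S k - S (Suc k)) sums (16 * beta4)" by simp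
  \<comment> \<open>The factor -15/2 undoes the -2/15 of \<open>wz_boundary\<close> and turns 16
    \<beta>(4) into -120 \<beta>(4).\<close>
  then have "(\<lambda>k. - 15 / 2 * (S k - S (Suc k))) sums (- 15 / 2 * (16 * beta4))"
    by (rule sums_mult)
  moreover have "- 15 / 2 * (- 2 / 15 * y) = y" "- 15 / 2 * (16 * beta4) = - 120 * beta4" for y :: real
    by simp_all
  ultimately show ?thesis
    unfolding step wz_boundary by (simp only: seriesA_def)
qed

end
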